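(* Let $f\colon\Gamma\to G$ be a group homomorphism and let $\tau_f\colon G\otimes_fG\to G\wedge_fG$ be the epimorphism induced by the natural epimorphism $\tau_G\colon G\otimes G\to G\wedge G$. Put $\nabla_f(G)=\ker\tau_f$. Then there is an exact sequence $$1\longrightarrow\nabla_f(G)\longrightarrow G\otimes_fG\xrightarrow{\ \tau_f\ }G\wedge_fG\longrightarrow1,$$ and $$\nabla_f(G)\cong\frac{\nabla(G)}{\nabla(G)\cap(f\otimes f)(J_2(\Gamma))}.$$
   Context: With ${}^{x}y=xyx^{-1}$ and $[x,y]=xyx^{-1}y^{-1}$, the non-abelian tensor square $G\otimes G$ is the group generated by symbols $g\otimes h$ ($g,h\in G$) with relations $gg'\otimes h=({}^{g}g'\otimes{}^{g}h)(g\otimes h)$, $g\otimes hh'=(g\otimes h)({}^{h}g\otimes{}^{h}h')$. The exterior square $G\wedge G$ is the quotient of $G\otimes G$ by the normal closure of all $g\otimes g$, and $\tau_G\colon G\otimes G\to G\wedge G$ is the quotient map. The commutator maps are $G\otimes G\to[G,G]$, $g\otimes h\mapsto[g,h]$, and $G\wedge G\to[G,G]$, $g\wedge h\mapsto[g,h]$. Put $J_2(G)=\ker(G\otimes G\to[G,G])$, which is central in $G\otimes G$, and $\nabla(G)=\ker\tau_G$. The kernel of $G\wedge G\to[G,G]$ is central and naturally identified with $H_2(G;\mathbb Z)$; under this identification $f_*H_2(\Gamma;\mathbb Z)$ is the image under $f\wedge f$ of $\ker(\Gamma\wedge\Gamma\to[\Gamma,\Gamma])$. For $f\colon\Gamma\to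 G$ put $$G\otimes_fG=\frac{G\otimes G}{(f\otimes f)(J_2(\Gamma))},\qquad G\wedge_fG=\frac{G\wedge G}{f_*H_2(\Gamma;\mathbb Z)}.$$ *)

theory Defs
  imports "HOL-Algebra.Generated_Groups"
begin

section \<open>Group presentations\<close>

text \<open>A word is a list of signed letters: \<open>(x, True)\<close> stands for the generator \<open>x\<close> and
  \<open>(x, False)\<close> for its formal inverse.  A relation \<open>u = v\<close> is a pair of words \<open>(u, v)\<close>.\<close>

type_synonym 'x word = "('x \<times> bool) list"

definition words :: "'x set \<Rightarrow> 'x word set"
  where "words X = lists (X \<times> UNIV)"

inductive_set pres_rel :: "'x set \<Rightarrow> ('x word \<times> 'x word) set \<Rightarrow> ('x word \<times> 'x word) set"
  for X and R where
  refl: "u \<in> words X \<Longrightarrow> (u, u) \<in> pres_rel X R"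
| sym: "(u, v) \<in> pres_rel X R \<Longrightarrow> (v, u) \<in> pres_rel X R"
| trans: "(u, v) \<in> pres_rel X R \<Longrightarrow> (v, w) \<in> pres_rel X R \<Longrightarrow> (u, w) \<in> pres_rel X R"
| cancel: "x \<in> X \<Longrightarrow> u \<in> words X \<Longrightarrow> v \<in> words X \<Longrightarrow>
    (u @ [(x, b), (x, \<not> b)] @ v, u @ v) \<in> pres_rel X R"
| rel: "(l, r) \<in> R \<Longrightarrow> l \<in> words X \<Longrightarrow> r \<in> words X \<Longrightarrow> u \<in> words X \<Longrightarrow> v \<in> words X \<Longrightarrow>
    (u @ l @ v, u @ r @ v) \<in> pres_rel X R"

definition word_class :: "'x set \<Rightarrow> ('x word \<times> 'x word) set \<Rightarrow> 'x word \<Rightarrow> 'x word set"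
  where "word_class X R w = pres_rel X R `` {w}"

definition presented_group :: "'x set \<Rightarrow> ('x word \<times> 'x word) set \<Rightarrow> 'x word set monoid"
  where "presented_group X R =
    \<lparr>carrier = words X // pres_rel X R,
     monoid.mult = (\<lambda>A B. \<Union>a\<in>A. \<Union>b\<in>B. word_class X R (a @ b)),
     one = word_class X R []\<rparr>"

definition pres_gen :: "'x set \<Rightarrow> ('x word \<times> 'x word) set \<Rightarrow> 'x \<Rightarrow> 'x word set"
  where "pres_gen X R x = word_class X R [(x, True)]"

definition word_eval :: "('b, 'm) monoid_scheme \<Rightarrow> ('x \<Rightarrow> 'b) \<Rightarrow> 'x word \<Rightarrow> 'b"
  where "word_eval H \<phi> w =
    foldr (\<lambda>(x, b) y. (if b then \<phi> x else inv\<^bsub>H\<^esub> (\<phi> x)) \<otimes>\<^bsub>H\<^esub> y) w \<one>\<^bsub>H\<^esub>"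

text \<open>The map on classes (cosets, or classes of words) induced by a map \<open>\<phi>\<close> on
  representatives; it is meaningful when \<open>\<phi>\<close> is constant on each class.\<close>

definition induced_map :: "('a \<Rightarrow> 'b) \<Rightarrow> 'a set \<Rightarrow> 'b"
  where "induced_map \<phi> = (\<lambda>A. the_elem (\<phi> ` A))"

definition normal_closure :: "('a, 'm) monoid_scheme \<Rightarrow> 'a set \<Rightarrow> 'a set"
  where "normal_closure G S = \<Inter>{N. N \<lhd> G \<and> S \<subseteq> N}"


section \<open>Tensor square and exterior square\<close>

definition conj_by :: "('a, 'm) monoid_scheme \<Rightarrow> 'a \<Rightarrow> 'a \<Rightarrow> 'a"
  where "conj_by G x y = x \<otimes>\<^bsub>G\<^esub> y \<otimes>\<^bsub>G\<^esub> inv\<^bsub>G\<^esub> x"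

definition commutator :: "('a, 'm) monoid_scheme \<Rightarrow> 'a \<Rightarrow> 'a \<Rightarrow> 'a"
  where "commutator G x y = x \<otimes>\<^bsub>G\<^esub> y \<otimes>\<^bsub>G\<^esub> inv\<^bsub>G\<^esub> x \<otimes>\<^bsub>G\<^esub> inv\<^bsub>G\<^esub> y"

abbreviation commutator_subgroup :: "('a, 'm) monoid_scheme \<Rightarrow> ('a, 'm) monoid_scheme"
  where "commutator_subgroup G \<equiv> G\<lparr>carrier := derived G (carrier G)\<rparr>"

definition tensor_rels ::
  "('a, 'm) monoid_scheme \<Rightarrow> (('a \<times> 'a) word \<times> ('a \<times> 'a) word) set"
  where "tensor_rels G =
    {([((g \<otimes>\<^bsub>G\<^esub> g', h), True)],
      [((conj_by G g g', conj_by G g h), True), ((g, h), True)]) | g g' h.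
        g \<in> carrier G \<and> g' \<in> carrier G \<and> h \<in> carrier G} \<union>
    {([((g, h \<otimes>\<^bsub>G\<^esub> h'), True)],
      [((g, h), True), ((conj_by G h g, conj_by G h h'), True)]) | g h h'.
        g \<in> carrier G \<and> h \<in> carrier G \<and> h' \<in> carrier G}"

definition tensor_square :: "('a, 'm) monoid_scheme \<Rightarrow> ('a \<times> 'a) word set monoid"
  where "tensor_square G = presented_group (carrier G \<times> carrier G) (tensor_rels G)"

definition tens :: "('a, 'm) monoid_scheme \<Rightarrow> 'a \<Rightarrow> 'a \<Rightarrow> ('a \<times> 'a) word set"
  where "tens G g h = pres_gen (carrier G \<times> carrier G) (tensor_rels G) (g, h)"

definition diagonal_closure :: "('a, 'm) monoid_scheme \<Rightarrow> ('a \<times> 'a) word set set"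
  where "diagonal_closure G =
    normal_closure (tensor_square G) {tens G g g | g. g \<in> carrier G}"

definition ext_square :: "('a, 'm) monoid_scheme \<Rightarrow> ('a \<times> 'a) word set set monoid"
  where "ext_square G = tensor_square G Mod diagonal_closure G"

text \<open>The quotient map \<open>\<tau>\<^sub>G\<close> and its kernel \<open>\<nabla>(G)\<close>.\<close>

definition tau :: "('a, 'm) monoid_scheme \<Rightarrow> ('a \<times> 'a) word set \<Rightarrow> ('a \<times> 'a) word set set"
  where "tau G t = diagonal_closure G #>\<^bsub>tensor_square G\<^esub> t"

definition nabla :: "('a, 'm) monoid_scheme \<Rightarrow> ('a \<times> 'a) word set set"
  where "nabla G = kernel (tensor_square G) (ext_square G) (tau G)"

definition tensor_comm :: "('a, 'm) monoid_scheme \<Rightarrow> ('a \<times> 'a) word set \<Rightarrow> 'a"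
  where "tensor_comm G =
    induced_map (word_eval (commutator_subgroup G) (\<lambda>(g, h). commutator G g h))"

definition ext_comm :: "('a, 'm) monoid_scheme \<Rightarrow> ('a \<times> 'a) word set set \<Rightarrow> 'a"
  where "ext_comm G = induced_map (tensor_comm G)"

definition J2 :: "('a, 'm) monoid_scheme \<Rightarrow> ('a \<times> 'a) word set set"
  where "J2 G = kernel (tensor_square G) (commutator_subgroup G) (tensor_comm G)"

text \<open>The second integral homology group is represented by the kernel of
  \<open>G \<and> G \<rightarrow> [G,G]\<close>, with which it is naturally identified.\<close>

definition H2 :: "('a, 'm) monoid_scheme \<Rightarrow> ('a \<times> 'a) word set set set"
  where "H2 G = kernel (ext_square G) (commutator_subgroup G) (ext_comm G)"

text \<open>\<open>f \<otimes> f\<close> sends the generator \<open>g \<otimes> h\<close> to \<open>f g \<otimes> f h\<close>; \<open>f \<and> f\<close> is induced by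
  \<open>\<tau>\<^sub>G \<circ> (f \<otimes> f)\<close>.\<close>

definition tensor_map :: "('a, 'm) monoid_scheme \<Rightarrow> ('b, 'n) monoid_scheme \<Rightarrow> ('a \<Rightarrow> 'b) \<Rightarrow>
    ('a \<times> 'a) word set \<Rightarrow> ('b \<times> 'b) word set"
  where "tensor_map \<Gamma> G f =
    induced_map (word_eval (tensor_square G) (\<lambda>(g, h). tens G (f g) (f h)))"

definition ext_map :: "('a, 'm) monoid_scheme \<Rightarrow> ('b, 'n) monoid_scheme \<Rightarrow> ('a \<Rightarrow> 'b) \<Rightarrow>
    ('a \<times> 'a) word set set \<Rightarrow> ('b \<times> 'b) word set set"
  where "ext_map \<Gamma> G f = induced_map (\<lambda>t. tau G (tensor_map \<Gamma> G f t))"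


section \<open>The squares relative to a homomorphism\<close>

definition J2_image :: "('a, 'm) monoid_scheme \<Rightarrow> ('b, 'n) monoid_scheme \<Rightarrow> ('a \<Rightarrow> 'b) \<Rightarrow>
    ('b \<times> 'b) word set set"
  where "J2_image \<Gamma> G f = tensor_map \<Gamma> G f ` J2 \<Gamma>"

definition H2_image :: "('a, 'm) monoid_scheme \<Rightarrow> ('b, 'n) monoid_scheme \<Rightarrow> ('a \<Rightarrow> 'b) \<Rightarrow>
    ('b \<times> 'b) word set set set"
  where "H2_image \<Gamma> G f = ext_map \<Gamma> G f ` H2 \<Gamma>"

definition tensor_square_rel ::
  "('a, 'm) monoid_scheme \<Rightarrow> ('b, 'n) monoid_scheme \<Rightarrow> ('a \<Rightarrow> 'b) \<Rightarrow>
    ('b \<times> 'b) word set set monoid"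
  where "tensor_square_rel \<Gamma> G f = tensor_square G Mod J2_image \<Gamma> G f"

definition ext_square_rel ::
  "('a, 'm) monoid_scheme \<Rightarrow> ('b, 'n) monoid_scheme \<Rightarrow> ('a \<Rightarrow> 'b) \<Rightarrow>
    ('b \<times> 'b) word set set set monoid"
  where "ext_square_rel \<Gamma> G f = ext_square G Mod H2_image \<Gamma> G f"

definition tau_rel :: "('a, 'm) monoid_scheme \<Rightarrow> ('b, 'n) monoid_scheme \<Rightarrow> ('a \<Rightarrow> 'b) \<Rightarrow>
    ('b \<times> 'b) word set set \<Rightarrow> ('b \<times> 'b) word set set set"
  where "tau_rel \<Gamma> G f = induced_map (\<lambda>t. H2_image \<Gamma> G f #>\<^bsub>ext_square G\<^esub> tau G t)"

definition nabla_rel :: "('a, 'm) monoid_scheme \<Rightarrow> ('b, 'n) monoid_scheme \<Rightarrow> ('a \<Rightarrow> 'b) \<Rightarrow>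
    ('b \<times> 'b) word set set set"
  where "nabla_rel \<Gamma> G f =
    kernel (tensor_square_rel \<Gamma> G f) (ext_square_rel \<Gamma> G f) (tau_rel \<Gamma> G f)"

text \<open>Exactness of \<open>1 \<rightarrow> A \<rightarrow> B \<rightarrow> C \<rightarrow> 1\<close>.  The library's \<open>short_exact_sequence\<close> requires all
  groups to live on one type, which fails for iterated quotients.\<close>

definition short_exact :: "('a, 'k) monoid_scheme \<Rightarrow> ('b, 'm) monoid_scheme \<Rightarrow>
    ('c, 'n) monoid_scheme \<Rightarrow> ('a \<Rightarrow> 'b) \<Rightarrow> ('b \<Rightarrow> 'c) \<Rightarrow> bool"
  where "short_exact A B C i p \<longleftrightarrow>
    group_hom A B i \<and> group_hom B C p \<and>
    kernel A B i = {\<one>\<^bsub>A\<^esub>} \<and>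
    i ` carrier A = kernel B C p \<and>
    p ` carrier B = carrier C"


section \<open>The presented groups and the maps out of them are as intended\<close>

lemma words_append: "u @ v \<in> words X \<longleftrightarrow> u \<in> words X \<and> v \<in> words X"
  by (auto simp: words_def)

lemma words_Nil [simp]: "[] \<in> words X"
  by (simp add: words_def)

lemma words_Cons: "p # v \<in> words X \<longleftrightarrow> fst p \<in> X \<and> v \<in> words X"
  by (cases p) (auto simp: words_def)

lemma pres_rel_words: "(u, v) \<in> pres_rel X R \<Longrightarrow> u \<in> words X \<and> v \<in> words X"
  by (induction rule: pres_rel.induct) (auto simp: words_append words_Cons)

lemma equiv_pres_rel: "equiv (words X) (pres_rel X R)"
  unfolding equiv_def refl_on_def sym_on_def trans_on_def
  by (auto dest: pres_rel_words intro: pres_rel.refl pres_rel.sym pres_rel.trans)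

lemma pres_rel_context:
  assumes "(u, v) \<in> pres_rel X R" "p \<in> words X" "q \<in> words X"
  shows "(p @ u @ q, p @ v @ q) \<in> pres_rel X R"
  using assms
proof (induction rule: pres_rel.induct)
  case (refl u) then show ?case by (simp add: pres_rel.refl words_append)
next
  case (sym u v) then show ?case by (simp add: pres_rel.sym)
next
  case (trans u v w) then show ?case by (meson pres_rel.trans)
next
  case (cancel x u v b)
  then show ?case
    using pres_rel.cancel[of x X "p @ u" "v @ q" b R] by (simp add: words_append)
next
  case (rel l r u v)
  then show ?case
    using pres_rel.rel[of l r R X "p @ u" "v @ q"] by (simp add: words_append)
qed

lemma pres_rel_append:
  assumes "(u, v) \<in> pres_rel X R" "(u', v') \<in> pres_rel X R"
  shows "(u @ u', v @ v') \<in> pres_rel X R"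
proof -
  have w: "u \<in> words X" "v \<in> words X" "u' \<in> words X" "v' \<in> words X"
    using assms pres_rel_words by blast+
  have "(u @ u', v @ u') \<in> pres_rel X R"
    using pres_rel_context[OF assms(1), of "[]" u'] w by simp
  moreover have "(v @ u', v @ v') \<in> pres_rel X R"
    using pres_rel_context[OF assms(2), of v "[]"] w by simp
  ultimately show ?thesis by (rule pres_rel.trans)
qed

lemma word_class_eq_iff:
  "u \<in> words X \<Longrightarrow> v \<in> words X \<Longrightarrow>
    word_class X R u = word_class X R v \<longleftrightarrow> (u, v) \<in> pres_rel X R"
  unfolding word_class_def using eq_equiv_class_iff[OF equiv_pres_rel] by blast

lemma word_class_mult:
  assumes "u \<in> words X" "v \<in> words X"
  shows "word_class X R u \<otimes>\<^bsub>presented_group X R\<^esub> word_class X R v = word_class X R (u @ v)"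
proof -
  have "word_class X R (a @ b) = word_class X R (u @ v)"
    if "a \<in> word_class X R u" "b \<in> word_class X R v" for a b
  proof -
    have ab: "(u, a) \<in> pres_rel X R" "(v, b) \<in> pres_rel X R"
      using that by (auto simp: word_class_def)
    have "(u @ v, a @ b) \<in> pres_rel X R" by (rule pres_rel_append[OF ab])
    then show ?thesis
      using word_class_eq_iff pres_rel_words by metis
  qed
  moreover have "u \<in> word_class X R u" "v \<in> word_class X R v"
    using assms by (auto simp: word_class_def intro: pres_rel.refl)
  ultimately have "(\<Union>a\<in>word_class X R u. \<Union>b\<in>word_class X R v. word_class X R (a @ b))
      = word_class X R (u @ v)"
    by blast
  then show ?thesis by (simp add: presented_group_def)
qed

lemma carrier_presented_group: "carrier (presented_group X R) = word_class X R ` words X"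
  by (auto simp: presented_group_def quotient_def word_class_def)

lemma one_presented_group: "\<one>\<^bsub>presented_group X R\<^esub> = word_class X R []"
  by (simp add: presented_group_def)

lemma word_class_inverse:
  assumes "w \<in> words X"
  shows "\<exists>w' \<in> words X. (w' @ w, []) \<in> pres_rel X R"
  using assms
proof (induction w)
  case Nil then show ?case by (intro bexI[of _ "[]"]) (auto intro: pres_rel.refl)
next
  case (Cons p w)
  obtain x b where p: "p = (x, b)" by force
  with Cons.prems have x: "x \<in> X" and w: "w \<in> words X" by (auto simp: words_Cons)
  obtain w' where w': "w' \<in> words X" "(w' @ w, []) \<in> pres_rel X R" using Cons.IH w by blast
  have "(w' @ [(x, \<not> b), (x, \<not> \<not> b)] @ w, w' @ w) \<in> pres_rel X R"
    by (rule pres_rel.cancel[OF x w'(1) w])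
  then have "((w' @ [(x, \<not> b)]) @ p # w, []) \<in> pres_rel X R"
    using pres_rel.trans[OF _ w'(2)] p by simp
  then show ?case
    using w' x by (intro bexI[of _ "w' @ [(x, \<not> b)]"]) (auto simp: words_append words_Cons)
qed

theorem group_presented_group: "group (presented_group X R)"
proof (rule groupI)
  fix x assume "x \<in> carrier (presented_group X R)"
  then obtain w where w: "w \<in> words X" "x = word_class X R w"
    by (auto simp: carrier_presented_group)
  obtain w' where w': "w' \<in> words X" "(w' @ w, []) \<in> pres_rel X R"
    using word_class_inverse w(1) by blast
  have "word_class X R (w' @ w) = word_class X R []"
    using w w' by (simp add: word_class_eq_iff words_append)
  then show "\<exists>y\<in>carrier (presented_group X R).
      y \<otimes>\<^bsub>presented_group X R\<^esub> x = \<one>\<^bsub>presented_group X R\<^esub>"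
    using w w' by (intro bexI[of _ "word_class X R w'"])
      (auto simp: word_class_mult one_presented_group carrier_presented_group)
qed (auto simp: carrier_presented_group word_class_mult one_presented_group words_append)

lemma word_eval_Nil [simp]: "word_eval H \<phi> [] = \<one>\<^bsub>H\<^esub>"
  by (simp add: word_eval_def)

lemma word_eval_Cons [simp]: "word_eval H \<phi> ((x, b) # w) =
    (if b then \<phi> x else inv\<^bsub>H\<^esub> (\<phi> x)) \<otimes>\<^bsub>H\<^esub> word_eval H \<phi> w"
  by (simp add: word_eval_def)

lemma word_eval_closed:
  assumes "group H" "\<phi> \<in> X \<rightarrow> carrier H" "w \<in> words X"
  shows "word_eval H \<phi> w \<in> carrier H"
proof -
  interpret group H by fact
  show ?thesis using assms(3)
  proof (induction w)
    case (Cons p w) then show ?case using assms(2) by (cases p) (auto simp: words_Cons)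
  qed simp
qed

lemma word_eval_append:
  assumes "group H" "\<phi> \<in> X \<rightarrow> carrier H" "u \<in> words X" "v \<in> words X"
  shows "word_eval H \<phi> (u @ v) = word_eval H \<phi> u \<otimes>\<^bsub>H\<^esub> word_eval H \<phi> v"
proof -
  interpret group H by fact
  show ?thesis using assms(3)
  proof (induction u)
    case Nil then show ?case using word_eval_closed[OF assms(1,2,4)] by simp
  next
    case (Cons p u)
    then show ?case
      using assms(2) word_eval_closed[OF assms(1,2,4)] word_eval_closed[OF assms(1,2), of u]
      by (cases p) (auto simp: words_Cons m_assoc Pi_iff)
  qed
qed

lemma word_eval_rel:
  assumes H: "group H" and \<phi>: "\<phi> \<in> X \<rightarrow> carrier H"
    and R: "\<And>l r. (l, r) \<in> R \<Longrightarrow> word_eval H \<phi> l = word_eval H \<phi> r"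
    and uv: "(u, v) \<in> pres_rel X R"
  shows "word_eval H \<phi> u = word_eval H \<phi> v"
  using uv
proof (induction rule: pres_rel.induct)
  case (cancel x u v b)
  interpret group H by fact
  have x: "\<phi> x \<in> carrier H" using cancel \<phi> by blast
  have c: "word_eval H \<phi> [(x, b), (x, \<not> b)] = \<one>\<^bsub>H\<^esub>" using x by simp
  have m: "[(x, b), (x, \<not> b)] \<in> words X" using cancel by (simp add: words_Cons)
  show ?case
    using cancel m c word_eval_closed[OF H \<phi>]
    by (simp add: word_eval_append[OF H \<phi>] words_append del: word_eval_Cons append_Cons append_Nil)
next
  case (rel l r u v)
  then show ?case using R by (simp add: word_eval_append[OF H \<phi>] words_append)
qed auto

lemma induced_map_word_class:
  assumes "group H" "\<phi> \<in> X \<rightarrow> carrier H"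
    and "\<And>l r. (l, r) \<in> R \<Longrightarrow> word_eval H \<phi> l = word_eval H \<phi> r" and w: "w \<in> words X"
  shows "induced_map (word_eval H \<phi>) (word_class X R w) = word_eval H \<phi> w"
proof -
  have "word_eval H \<phi> ` word_class X R w = {word_eval H \<phi> w}"
    using word_eval_rel[OF assms(1-3)] pres_rel.refl[OF w] by (fastforce simp: word_class_def)
  then show ?thesis by (simp add: induced_map_def)
qed

theorem presented_group_universal:
  assumes "group H" "\<phi> \<in> X \<rightarrow> carrier H"
    and "\<And>l r. (l, r) \<in> R \<Longrightarrow> word_eval H \<phi> l = word_eval H \<phi> r"
  shows "induced_map (word_eval H \<phi>) \<in> hom (presented_group X R) H"
    and "x \<in> X \<Longrightarrow> induced_map (word_eval H \<phi>) (pres_gen X R x) = \<phi> x"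
proof -
  interpret group H by fact
  note [simp] = induced_map_word_class[OF assms]
  show "induced_map (word_eval H \<phi>) \<in> hom (presented_group X R) H"
    by (auto simp: hom_def carrier_presented_group word_class_mult words_append
        word_eval_append[OF assms(1,2)] word_eval_closed[OF assms(1,2)])
  show "induced_map (word_eval H \<phi>) (pres_gen X R x) = \<phi> x" if "x \<in> X"
    using that assms(2) by (auto simp: pres_gen_def words_Cons Pi_iff)
qed

lemma group_tensor_square: "group (tensor_square G)"
  by (simp add: tensor_square_def group_presented_group)

lemma tens_closed:
  "g \<in> carrier G \<Longrightarrow> h \<in> carrier G \<Longrightarrow> tens G g h \<in> carrier (tensor_square G)"
  by (auto simp: tens_def pres_gen_def tensor_square_def carrier_presented_group words_Cons)

lemma (in group) conj_by_closed:
  "x \<in> carrier G \<Longrightarrow> y \<in> carrier G \<Longrightarrow> conj_by G x y \<in> carrier G"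
  by (simp add: conj_by_def)

lemma (in group) tens_rel_left:
  assumes [simp]: "g \<in> carrier G" "g' \<in> carrier G" "h \<in> carrier G"
  shows "tens G (g \<otimes> g') h =
    tens G (conj_by G g g') (conj_by G g h) \<otimes>\<^bsub>tensor_square G\<^esub> tens G g h"
proof -
  let ?X = "carrier G \<times> carrier G" and ?R = "tensor_rels G"
  let ?l = "[((g \<otimes> g', h), True)]"
  let ?r = "[((conj_by G g g', conj_by G g h), True), ((g, h), True)]"
  have lr: "(?l, ?r) \<in> ?R" using assms by (auto simp: tensor_rels_def)
  have w: "?l \<in> words ?X" "?r \<in> words ?X" by (simp_all add: words_Cons conj_by_closed)
  have "(?l, ?r) \<in> pres_rel ?X ?R" using pres_rel.rel[OF lr w, of "[]" "[]"] by simp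
  then show ?thesis
    unfolding tens_def pres_gen_def tensor_square_def
    using w by (subst word_class_mult) (simp_all add: word_class_eq_iff words_Cons)
qed

lemma (in group) tens_rel_right:
  assumes [simp]: "g \<in> carrier G" "h \<in> carrier G" "h' \<in> carrier G"
  shows "tens G g (h \<otimes> h') =
    tens G g h \<otimes>\<^bsub>tensor_square G\<^esub> tens G (conj_by G h g) (conj_by G h h')"
proof -
  let ?X = "carrier G \<times> carrier G" and ?R = "tensor_rels G"
  let ?l = "[((g, h \<otimes> h'), True)]"
  let ?r = "[((g, h), True), ((conj_by G h g, conj_by G h h'), True)]"
  have lr: "(?l, ?r) \<in> ?R" using assms by (auto simp: tensor_rels_def)
  have w: "?l \<in> words ?X" "?r \<in> words ?X" by (simp_all add: words_Cons conj_by_closed)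
  have "(?l, ?r) \<in> pres_rel ?X ?R" using pres_rel.rel[OF lr w, of "[]" "[]"] by simp
  then show ?thesis
    unfolding tens_def pres_gen_def tensor_square_def
    using w by (subst word_class_mult) (simp_all add: word_class_eq_iff words_Cons)
qed

theorem tensor_map_hom:
  assumes "group \<Gamma>" "group G" "f \<in> hom \<Gamma> G"
  shows "tensor_map \<Gamma> G f \<in> hom (tensor_square \<Gamma>) (tensor_square G)"
    and "g \<in> carrier \<Gamma> \<Longrightarrow> h \<in> carrier \<Gamma> \<Longrightarrow>
      tensor_map \<Gamma> G f (tens \<Gamma> g h) = tens G (f g) (f h)"
proof -
  interpret group_hom \<Gamma> G f
    using assms by (simp add: group_hom_def group_hom_axioms_def)
  interpret T: group "tensor_square G" by (rule group_tensor_square)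
  let ?\<phi> = "\<lambda>(g, h). tens G (f g) (f h)"
  have conj: "f (conj_by \<Gamma> x y) = conj_by G (f x) (f y)"
    if "x \<in> carrier \<Gamma>" "y \<in> carrier \<Gamma>" for x y
    using that by (simp add: conj_by_def)
  have 1: "?\<phi> \<in> carrier \<Gamma> \<times> carrier \<Gamma> \<rightarrow> carrier (tensor_square G)"
    by (auto intro!: tens_closed)
  have 2: "word_eval (tensor_square G) ?\<phi> l = word_eval (tensor_square G) ?\<phi> r"
    if "(l, r) \<in> tensor_rels \<Gamma>" for l r
    using that by (auto simp: tensor_rels_def conj tens_closed H.tens_rel_left H.tens_rel_right
        H.conj_by_closed)
  show "tensor_map \<Gamma> G f \<in> hom (tensor_square \<Gamma>) (tensor_square G)"
    using presented_group_universal(1)[OF group_tensor_square 1 2]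
    by (simp add: tensor_map_def tensor_square_def)
  show "tensor_map \<Gamma> G f (tens \<Gamma> g h) = tens G (f g) (f h)"
    if "g \<in> carrier \<Gamma>" "h \<in> carrier \<Gamma>"
    using presented_group_universal(2)[OF group_tensor_square 1 2] that
    by (simp add: tensor_map_def tens_def)
qed

theorem (in group) tensor_comm_hom:
  shows "tensor_comm G \<in> hom (tensor_square G) (commutator_subgroup G)"
    and "g \<in> carrier G \<Longrightarrow> h \<in> carrier G \<Longrightarrow> tensor_comm G (tens G g h) = commutator G g h"
proof -
  have D: "group (commutator_subgroup G)"
    by (rule subgroup.subgroup_is_group[OF derived_is_subgroup]) simp_all
  have c: "commutator G g h \<in> derived G (carrier G)"
    if "g \<in> carrier G" "h \<in> carrier G" for g h
    unfolding derived_def commutator_def using that by (blast intro: generate.incl)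
  let ?\<phi> = "\<lambda>(g, h). commutator G g h"
  have 1: "?\<phi> \<in> carrier G \<times> carrier G \<rightarrow> carrier (commutator_subgroup G)"
    using c by auto
  have i: "inv x \<otimes> (x \<otimes> y) = y" "x \<otimes> (inv x \<otimes> y) = y"
    if "x \<in> carrier G" "y \<in> carrier G" for x y
    using that by (simp_all flip: m_assoc)
  have 2: "word_eval (commutator_subgroup G) ?\<phi> l = word_eval (commutator_subgroup G) ?\<phi> r"
    if "(l, r) \<in> tensor_rels G" for l r
    using that
    by (auto simp: tensor_rels_def commutator_def conj_by_def m_assoc inv_mult_group i)
  show "tensor_comm G \<in> hom (tensor_square G) (commutator_subgroup G)"
    using presented_group_universal(1)[OF D 1 2]
    by (simp add: tensor_comm_def tensor_square_def)
  show "tensor_comm G (tens G g h) = commutator G g h"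
    if "g \<in> carrier G" "h \<in> carrier G"
    using presented_group_universal(2)[OF D 1 2] that
    by (simp add: tensor_comm_def tens_def)
qed

lemma normal_normal_closure:
  assumes "group G" "S \<subseteq> carrier G"
  shows "normal_closure G S \<lhd> G" "S \<subseteq> normal_closure G S"
    "N \<lhd> G \<Longrightarrow> S \<subseteq> N \<Longrightarrow> normal_closure G S \<subseteq> N"
proof -
  interpret group G by fact
  let ?F = "{N. N \<lhd> G \<and> S \<subseteq> N}"
  have "carrier G \<lhd> G" by (simp add: normal_inv_iff subgroup_self)
  then have ne: "carrier G \<in> ?F" using assms by blast
  have "subgroup (\<Inter>?F) G"
    by (rule subgroups_Inter) (use ne in \<open>auto simp: normal_imp_subgroup\<close>)
  then show "normal_closure G S \<lhd> G"
    unfolding normal_closure_def by (auto simp: normal_inv_iff)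
qed (auto simp: normal_closure_def)

lemma diagonal_closure_normal: "diagonal_closure G \<lhd> tensor_square G"
  unfolding diagonal_closure_def
  by (rule normal_normal_closure) (auto simp: group_tensor_square tens_closed)

lemma group_ext_square: "group (ext_square G)"
  by (simp add: ext_square_def diagonal_closure_normal normal.factorgroup_is_group)

lemma tau_hom: "tau G \<in> hom (tensor_square G) (ext_square G)"
proof -
  have "tau G = (\<lambda>t. diagonal_closure G #>\<^bsub>tensor_square G\<^esub> t)" by (simp add: tau_def fun_eq_iff)
  then show ?thesis
    using normal.r_coset_hom_Mod[OF diagonal_closure_normal, of G] by (simp add: ext_square_def)
qed

lemma induced_map_FactGroup:
  assumes "N \<lhd> G" "group H" "\<phi> \<in> hom G H" "N \<subseteq> kernel G H \<phi>"
  shows "induced_map \<phi> \<in> hom (G Mod N) H"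
    and "x \<in> carrier G \<Longrightarrow> induced_map \<phi> (N #>\<^bsub>G\<^esub> x) = \<phi> x"
proof -
  interpret normal N G by fact
  interpret group_hom G H \<phi> using assms by (simp add: group_hom_def group_hom_axioms_def)
  have v: "induced_map \<phi> (N #>\<^bsub>G\<^esub> x) = \<phi> x" if "x \<in> carrier G" for x
  proof -
    have n: "\<phi> (n \<otimes>\<^bsub>G\<^esub> x) = \<phi> x" if "n \<in> N" for n
      using assms(4) that \<open>x \<in> carrier G\<close> by (auto simp: kernel_def subset_iff)
    have "\<phi> ` (N #>\<^bsub>G\<^esub> x) = (\<lambda>n. \<phi> (n \<otimes>\<^bsub>G\<^esub> x)) ` N"
      unfolding r_coset_def by blast
    also have "\<dots> = (\<lambda>n. \<phi> x) ` N" by (rule image_cong[OF HOL.refl n])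
    also have "\<dots> = {\<phi> x}"
      using subgroup.one_closed[OF normal_imp_subgroup[OF assms(1)]] by blast
    finally have "\<phi> ` (N #>\<^bsub>G\<^esub> x) = {\<phi> x}" .
    then show ?thesis by (simp add: induced_map_def)
  qed
  then show "x \<in> carrier G \<Longrightarrow> induced_map \<phi> (N #>\<^bsub>G\<^esub> x) = \<phi> x" .
  show "induced_map \<phi> \<in> hom (G Mod N) H"
    by (auto simp: hom_def carrier_FactGroup v rcos_sum)
qed

lemma diagonal_closure_subset_kernel:
  assumes "group H" "\<phi> \<in> hom (tensor_square G) H"
    and "\<And>g. g \<in> carrier G \<Longrightarrow> \<phi> (tens G g g) = \<one>\<^bsub>H\<^esub>"
  shows "diagonal_closure G \<subseteq> kernel (tensor_square G) H \<phi>"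
proof -
  interpret group_hom "tensor_square G" H \<phi>
    using assms by (simp add: group_hom_def group_hom_axioms_def group_tensor_square)
  show ?thesis
    unfolding diagonal_closure_def
    by (rule normal_normal_closure(3)[OF group_tensor_square _ normal_kernel])
      (auto simp: kernel_def tens_closed assms(3))
qed

lemma tau_tens_diagonal:
  assumes "g \<in> carrier G"
  shows "tau G (tens G g g) = \<one>\<^bsub>ext_square G\<^esub>"
proof -
  interpret normal "diagonal_closure G" "tensor_square G" by (rule diagonal_closure_normal)
  have "tens G g g \<in> diagonal_closure G"
    unfolding diagonal_closure_def
    by (rule subsetD[OF normal_normal_closure(2)])
      (use assms in \<open>auto simp: group_tensor_square tens_closed\<close>)
  then show ?thesis
    by (simp add: tau_def ext_square_def rcos_const)
qed

theorem (in group) ext_comm_hom: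
  shows "ext_comm G \<in> hom (ext_square G) (commutator_subgroup G)"
    and "g \<in> carrier G \<Longrightarrow> h \<in> carrier G \<Longrightarrow>
      ext_comm G (tau G (tens G g h)) = commutator G g h"
proof -
  have D: "group (commutator_subgroup G)"
    by (rule subgroup.subgroup_is_group[OF derived_is_subgroup]) simp_all
  have k: "diagonal_closure G \<subseteq> kernel (tensor_square G) (commutator_subgroup G) (tensor_comm G)"
    by (rule diagonal_closure_subset_kernel[OF D tensor_comm_hom(1)])
      (simp add: tensor_comm_hom(2) commutator_def m_assoc)
  note * = induced_map_FactGroup[OF diagonal_closure_normal D tensor_comm_hom(1) k]
  show "ext_comm G \<in> hom (ext_square G) (commutator_subgroup G)"
    using *(1) by (simp add: ext_comm_def ext_square_def)
  show "ext_comm G (tau G (tens G g h)) = commutator G g h"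
    if "g \<in> carrier G" "h \<in> carrier G"
    using *(2) that by (simp add: ext_comm_def tau_def tens_closed tensor_comm_hom(2))
qed

theorem ext_map_hom:
  assumes "group \<Gamma>" "group G" "f \<in> hom \<Gamma> G"
  shows "ext_map \<Gamma> G f \<in> hom (ext_square \<Gamma>) (ext_square G)"
    and "t \<in> carrier (tensor_square \<Gamma>) \<Longrightarrow>
      ext_map \<Gamma> G f (tau \<Gamma> t) = tau G (tensor_map \<Gamma> G f t)"
proof -
  let ?\<phi> = "\<lambda>t. tau G (tensor_map \<Gamma> G f t)"
  have h: "?\<phi> \<in> hom (tensor_square \<Gamma>) (ext_square G)"
    using hom_compose[OF tensor_map_hom(1)[OF assms] tau_hom] by (simp add: comp_def)
  have k: "diagonal_closure \<Gamma> \<subseteq> kernel (tensor_square \<Gamma>) (ext_square G) ?\<phi>"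
    by (rule diagonal_closure_subset_kernel[OF group_ext_square h])
      (use assms(3) in \<open>auto simp: tensor_map_hom(2)[OF assms] hom_def intro!: tau_tens_diagonal\<close>)
  note * = induced_map_FactGroup[OF diagonal_closure_normal group_ext_square h k]
  show "ext_map \<Gamma> G f \<in> hom (ext_square \<Gamma>) (ext_square G)"
    using *(1) by (simp add: ext_map_def ext_square_def)
  show "ext_map \<Gamma> G f (tau \<Gamma> t) = tau G (tensor_map \<Gamma> G f t)"
    if "t \<in> carrier (tensor_square \<Gamma>)"
    using *(2)[OF that] by (simp add: ext_map_def tau_def)
qed

end

theory Submission
  imports Defs
begin

text \<open>
  Let \<open>T = G \<otimes> G\<close>, let \<open>\<partial> : T \<rightarrow> [G,G]\<close> be the commutator map, and let \<open>J\<close> be the image of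
  \<open>J\<^sub>2(\<Gamma>)\<close> in \<open>T\<close>.  Everything reduces to one fact about a surjective homomorphism
  \<open>h : T \<rightarrow> E\<close> and a normal subgroup \<open>J\<close> of \<open>T\<close>: the induced map \<open>T/J \<rightarrow> E/h(J)\<close> is onto, and
  its kernel is the image of \<open>ker h\<close> in \<open>T/J\<close> (\<open>group_hom.induced_Mod_image\<close>).  Indeed, if
  \<open>h(t) = h(j)\<close> with \<open>j \<in> J\<close>, then \<open>j\<^sup>-\<^sup>1 t\<close> lies in \<open>ker h\<close> and in the coset of \<open>t\<close>.  By the
  second isomorphism theorem (\<open>group.image_in_Mod_iso\<close>) this kernel is
  \<open>ker h / (ker h \<inter> J)\<close>.  For \<open>h = \<tau>\<^sub>G\<close> this is the claim, once two points are settled.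

  The first is that \<open>J\<close> is normal in \<open>T\<close>.  The homomorphism \<open>f \<otimes> f\<close> need not be onto, so
  normality of \<open>J\<^sub>2(\<Gamma>)\<close> in \<open>\<Gamma> \<otimes> \<Gamma>\<close> says nothing here; instead \<open>J\<close> lies in \<open>J\<^sub>2(G) = ker \<partial>\<close>,
  because \<open>f\<close> commutes with the commutator maps, and \<open>J\<^sub>2(G)\<close> is central (\<open>group.J2_central\<close>).
  Centrality comes from the identity \<open>t (a \<otimes> b) t\<^sup>-\<^sup>1 = \<^sup>c a \<otimes> \<^sup>c b\<close> with \<open>c = \<partial> t\<close>
  (\<open>group.tensor_square_conj_tens\<close>): an element with \<open>\<partial> t = 1\<close> commutes with every generator.

  The second is that the image of \<open>H\<^sub>2(\<Gamma>)\<close> in \<open>E = G \<and> G\<close> equals \<open>\<tau>\<^sub>G(J)\<close>.  Since \<open>\<tau>\<^sub>\<Gamma>\<close> is onto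
  and compatible with the commutator maps, \<open>H\<^sub>2(\<Gamma>) = \<tau>\<^sub>\<Gamma>(J\<^sub>2(\<Gamma>))\<close>, and
  \<open>(f \<and> f) \<circ> \<tau>\<^sub>\<Gamma> = \<tau>\<^sub>G \<circ> (f \<otimes> f)\<close>.
\<close>

section \<open>Generation by the pure tensors\<close>

lemma inv_pres_gen:
  assumes "x \<in> X"
  shows "inv\<^bsub>presented_group X R\<^esub> pres_gen X R x = word_class X R [(x, False)]"
proof -
  interpret group "presented_group X R" by (rule group_presented_group)
  have "(([] :: 'a word) @ [(x, False), (x, \<not> False)] @ [], [] @ []) \<in> pres_rel X R"
    using assms by (intro pres_rel.cancel) simp_all
  then have "word_class X R [(x, False)] \<otimes>\<^bsub>presented_group X R\<^esub> pres_gen X R x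
      = \<one>\<^bsub>presented_group X R\<^esub>"
    using assms
    by (simp add: pres_gen_def word_class_mult one_presented_group word_class_eq_iff words_Cons)
  then show ?thesis
    using assms
    by (intro inv_equality) (auto simp: pres_gen_def carrier_presented_group words_Cons)
qed

text \<open>This gives induction over generators: two homomorphisms that agree on the generators agree,
  and an element that commutes with the generators is central.\<close>

lemma presented_group_generated:
  assumes K: "subgroup K (presented_group X R)"
    and gen: "\<And>x. x \<in> X \<Longrightarrow> pres_gen X R x \<in> K"
  shows "carrier (presented_group X R) \<subseteq> K"
proof -
  interpret group "presented_group X R" by (rule group_presented_group)
  have "word_class X R w \<in> K" if "w \<in> words X" for w
    using that
  proof (induction w)
    case Nil
    then show ?case using subgroup.one_closed[OF K] by (simp add: one_presented_group)
  next
    case (Cons p w)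
    obtain x b where p: "p = (x, b)" by force
    with Cons.prems have x: "x \<in> X" and w: "w \<in> words X" by (auto simp: words_Cons)
    have "word_class X R [p] \<in> K"
      using gen[OF x] subgroup.m_inv_closed[OF K gen[OF x]] inv_pres_gen[OF x, of R] p
      by (cases b) (simp_all add: pres_gen_def)
    moreover have "word_class X R (p # w)
        = word_class X R [p] \<otimes>\<^bsub>presented_group X R\<^esub> word_class X R w"
      using x w p by (simp add: word_class_mult words_Cons)
    ultimately show ?case using subgroup.m_closed[OF K] Cons.IH[OF w] by simp
  qed
  then show ?thesis by (auto simp: carrier_presented_group)
qed

corollary tensor_square_generated:
  assumes "subgroup K (tensor_square G)"
    and "\<And>g h. g \<in> carrier G \<Longrightarrow> h \<in> carrier G \<Longrightarrow> tens G g h \<in> K"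
  shows "carrier (tensor_square G) \<subseteq> K"
  using presented_group_generated[of K "carrier G \<times> carrier G" "tensor_rels G"] assms
  by (auto simp: tensor_square_def tens_def)

section \<open>Centrality of the kernel of the commutator map\<close>

context group
begin

lemma conj_by_mult:
  assumes "x \<in> carrier G" "y \<in> carrier G" "z \<in> carrier G"
  shows "conj_by G x (y \<otimes> z) = conj_by G x y \<otimes> conj_by G x z"
proof -
  have "inv x \<otimes> (x \<otimes> w) = w" if "w \<in> carrier G" for w
    using that assms by (simp flip: m_assoc)
  then show ?thesis using assms by (simp add: conj_by_def m_assoc)
qed

lemma conj_by_conj_by:
  assumes "x \<in> carrier G" "y \<in> carrier G" "z \<in> carrier G"
  shows "conj_by G x (conj_by G y z) = conj_by G (x \<otimes> y) z"
  using assms by (simp add: conj_by_def m_assoc inv_mult_group)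

lemma conj_by_one: "x \<in> carrier G \<Longrightarrow> conj_by G \<one> x = x"
  by (simp add: conj_by_def)

text \<open>The product \<open>gx \<otimes> hy\<close> can be expanded by splitting \<open>gx\<close> first or \<open>hy\<close> first.  Both
  expansions begin with \<open>\<^sup>g x \<otimes> \<^sup>g h\<close> and end with \<open>\<^sup>h g \<otimes> \<^sup>h y\<close>; cancelling these leaves the
  identity.\<close>

lemma tens_mult_mult_swap:
  assumes [simp]: "g \<in> carrier G" "h \<in> carrier G" "x \<in> carrier G" "y \<in> carrier G"
  shows "tens G (conj_by G (g \<otimes> h) x) (conj_by G (g \<otimes> h) y) \<otimes>\<^bsub>tensor_square G\<^esub> tens G g h
    = tens G g h \<otimes>\<^bsub>tensor_square G\<^esub> tens G (conj_by G (h \<otimes> g) x) (conj_by G (h \<otimes> g) y)"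
    (is "?L \<otimes>\<^bsub>?T\<^esub> _ = _ \<otimes>\<^bsub>?T\<^esub> ?R")
proof -
  interpret T: group ?T by (rule group_tensor_square)
  let ?A = "tens G (conj_by G g x) (conj_by G g h)"
  let ?B = "tens G (conj_by G h g) (conj_by G h y)"
  note [simp] = tens_closed conj_by_closed conj_by_mult conj_by_conj_by
  have gh: "conj_by G g h \<otimes> g = g \<otimes> h" if "g \<in> carrier G" "h \<in> carrier G" for g h
    using that by (simp add: conj_by_def m_assoc)
  have l: "tens G (g \<otimes> x) (h \<otimes> y) = (?A \<otimes>\<^bsub>?T\<^esub> ?L) \<otimes>\<^bsub>?T\<^esub> (tens G g h \<otimes>\<^bsub>?T\<^esub> ?B)"
    by (subst tens_rel_left) (simp_all add: tens_rel_right gh)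
  have r: "tens G (g \<otimes> x) (h \<otimes> y) = (?A \<otimes>\<^bsub>?T\<^esub> tens G g h) \<otimes>\<^bsub>?T\<^esub> (?R \<otimes>\<^bsub>?T\<^esub> ?B)"
    by (subst tens_rel_right) (simp_all add: tens_rel_left gh)
  have "?A \<otimes>\<^bsub>?T\<^esub> ((?L \<otimes>\<^bsub>?T\<^esub> tens G g h) \<otimes>\<^bsub>?T\<^esub> ?B) = ?A \<otimes>\<^bsub>?T\<^esub> ((tens G g h \<otimes>\<^bsub>?T\<^esub> ?R) \<otimes>\<^bsub>?T\<^esub> ?B)"
    using l r by (simp add: T.m_assoc)
  then show ?thesis by simp
qed

text \<open>Taking for \<open>x\<close> and \<open>y\<close> in the previous identity the conjugates of \<open>a\<close> and \<open>b\<close> by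
  \<open>(hg)\<^sup>-\<^sup>1\<close> turns its right-hand factor into \<open>a \<otimes> b\<close>, and \<open>gh(hg)\<^sup>-\<^sup>1 = [g,h]\<close>.\<close>

lemma tens_conj_tens:
  assumes "g \<in> carrier G" "h \<in> carrier G" "a \<in> carrier G" "b \<in> carrier G"
  shows "tens G g h \<otimes>\<^bsub>tensor_square G\<^esub> tens G a b
    = tens G (conj_by G (commutator G g h) a) (conj_by G (commutator G g h) b)
      \<otimes>\<^bsub>tensor_square G\<^esub> tens G g h"
proof -
  have c: "g \<otimes> h \<otimes> inv (h \<otimes> g) = commutator G g h"
    using assms by (simp add: commutator_def inv_mult_group m_assoc)
  show ?thesis
    using tens_mult_mult_swap[of g h "conj_by G (inv (h \<otimes> g)) a" "conj_by G (inv (h \<otimes> g)) b"] assms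
    by (simp add: conj_by_conj_by conj_by_closed conj_by_one c r_inv del: inv_mult_group)
qed

lemma tensor_comm_closed:
  assumes "t \<in> carrier (tensor_square G)"
  shows "tensor_comm G t \<in> carrier G"
  using hom_in_carrier[OF tensor_comm_hom(1) assms] derived_in_carrier[of "carrier G"] by auto

lemma group_hom_tensor_comm: "group_hom (tensor_square G) G (tensor_comm G)"
proof -
  have "tensor_comm G \<in> hom (tensor_square G) G"
    using tensor_comm_hom(1) tensor_comm_closed by (auto simp: hom_def)
  then show ?thesis
    by (simp add: group_hom_def group_hom_axioms_def group_tensor_square is_group)
qed

lemma J2_eq: "J2 G = {t \<in> carrier (tensor_square G). tensor_comm G t = \<one>}"
  by (simp add: J2_def kernel_def)

text \<open>The elements \<open>t\<close> with this property form a subgroup, because \<open>\<partial>\<close> is a homomorphism and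
  conjugation is an action; it contains the generators by \<open>tens_conj_tens\<close>.\<close>

lemma tensor_square_conj_tens:
  assumes t: "t \<in> carrier (tensor_square G)" and ab: "a \<in> carrier G" "b \<in> carrier G"
  shows "t \<otimes>\<^bsub>tensor_square G\<^esub> tens G a b
    = tens G (conj_by G (tensor_comm G t) a) (conj_by G (tensor_comm G t) b)
      \<otimes>\<^bsub>tensor_square G\<^esub> t"
proof -
  let ?T = "tensor_square G"
  interpret d: group_hom ?T G "tensor_comm G" by (rule group_hom_tensor_comm)
  define c where "c t a b = tens G (conj_by G (tensor_comm G t) a) (conj_by G (tensor_comm G t) b)"
    for t a b
  define K where "K = {t \<in> carrier ?T. \<forall>a\<in>carrier G. \<forall>b\<in>carrier G.
      t \<otimes>\<^bsub>?T\<^esub> tens G a b = c t a b \<otimes>\<^bsub>?T\<^esub> t}"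
  have c_closed: "c t a b \<in> carrier ?T"
    if "t \<in> carrier ?T" "a \<in> carrier G" "b \<in> carrier G" for t a b
    using that by (simp add: c_def tens_closed conj_by_closed)
  have K: "subgroup K ?T"
  proof (rule d.G.subgroupI)
    show "K \<subseteq> carrier ?T" by (auto simp: K_def)
    have "\<one>\<^bsub>?T\<^esub> \<in> K" by (simp add: K_def c_def conj_by_one tens_closed)
    then show "K \<noteq> {}" by blast
  next
    fix s t assume s: "s \<in> K" and t: "t \<in> K"
    then have [simp]: "s \<in> carrier ?T" "t \<in> carrier ?T" by (auto simp: K_def)
    have "s \<otimes>\<^bsub>?T\<^esub> t \<otimes>\<^bsub>?T\<^esub> tens G a b = c (s \<otimes>\<^bsub>?T\<^esub> t) a b \<otimes>\<^bsub>?T\<^esub> (s \<otimes>\<^bsub>?T\<^esub> t)"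
      if ab[simp]: "a \<in> carrier G" "b \<in> carrier G" for a b
    proof -
      have "s \<otimes>\<^bsub>?T\<^esub> t \<otimes>\<^bsub>?T\<^esub> tens G a b = s \<otimes>\<^bsub>?T\<^esub> (c t a b \<otimes>\<^bsub>?T\<^esub> t)"
        using t by (simp add: K_def d.G.m_assoc tens_closed)
      also have "\<dots> = (s \<otimes>\<^bsub>?T\<^esub> c t a b) \<otimes>\<^bsub>?T\<^esub> t"
        by (simp add: d.G.m_assoc c_closed)
      also have "s \<otimes>\<^bsub>?T\<^esub> c t a b = c (s \<otimes>\<^bsub>?T\<^esub> t) a b \<otimes>\<^bsub>?T\<^esub> s"
        using s by (simp add: K_def c_def conj_by_closed conj_by_conj_by)
      finally show ?thesis by (simp add: d.G.m_assoc c_closed)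
    qed
    then show "s \<otimes>\<^bsub>?T\<^esub> t \<in> K" by (simp add: K_def)
  next
    fix t assume t: "t \<in> K"
    then have [simp]: "t \<in> carrier ?T" by (auto simp: K_def)
    have "inv\<^bsub>?T\<^esub> t \<otimes>\<^bsub>?T\<^esub> tens G a b = c (inv\<^bsub>?T\<^esub> t) a b \<otimes>\<^bsub>?T\<^esub> inv\<^bsub>?T\<^esub> t"
      if ab[simp]: "a \<in> carrier G" "b \<in> carrier G" for a b
    proof -
      \<comment> \<open>The property of \<open>t\<close>, applied to \<open>a\<close> and \<open>b\<close> conjugated by \<open>(\<partial> t)\<^sup>-\<^sup>1\<close>.\<close>
      have "t \<otimes>\<^bsub>?T\<^esub> c (inv\<^bsub>?T\<^esub> t) a b = tens G a b \<otimes>\<^bsub>?T\<^esub> t"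
        using t by (simp add: K_def c_def conj_by_closed conj_by_conj_by conj_by_one)
      then have "inv\<^bsub>?T\<^esub> t \<otimes>\<^bsub>?T\<^esub> (t \<otimes>\<^bsub>?T\<^esub> c (inv\<^bsub>?T\<^esub> t) a b) \<otimes>\<^bsub>?T\<^esub> inv\<^bsub>?T\<^esub> t
          = inv\<^bsub>?T\<^esub> t \<otimes>\<^bsub>?T\<^esub> (tens G a b \<otimes>\<^bsub>?T\<^esub> t) \<otimes>\<^bsub>?T\<^esub> inv\<^bsub>?T\<^esub> t"
        by simp
      then show ?thesis
        by (simp add: d.G.m_assoc c_closed tens_closed d.G.inv_solve_left')
    qed
    then show "inv\<^bsub>?T\<^esub> t \<in> K" by (simp add: K_def)
  qed
  have "tens G g h \<in> K" if "g \<in> carrier G" "h \<in> carrier G" for g h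
    using that by (simp add: K_def c_def tens_closed tensor_comm_hom(2) tens_conj_tens)
  then have "carrier ?T \<subseteq> K" by (rule tensor_square_generated[OF K])
  then show ?thesis using t ab by (auto simp: K_def c_def)
qed

lemma J2_central:
  assumes z: "z \<in> J2 G" and t: "t \<in> carrier (tensor_square G)"
  shows "z \<otimes>\<^bsub>tensor_square G\<^esub> t = t \<otimes>\<^bsub>tensor_square G\<^esub> z"
proof -
  let ?T = "tensor_square G"
  interpret T: group ?T by (rule group_tensor_square)
  have zc[simp]: "z \<in> carrier ?T" and z1: "tensor_comm G z = \<one>" using z by (auto simp: J2_eq)
  let ?K = "{t \<in> carrier ?T. z \<otimes>\<^bsub>?T\<^esub> t = t \<otimes>\<^bsub>?T\<^esub> z}"
  have K: "subgroup ?K ?T"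
  proof (rule T.subgroupI)
    show "?K \<noteq> {}" using T.one_closed zc by force
  next
    fix s t assume st: "s \<in> ?K" "t \<in> ?K"
    then have [simp]: "s \<in> carrier ?T" "t \<in> carrier ?T" by auto
    have "z \<otimes>\<^bsub>?T\<^esub> (s \<otimes>\<^bsub>?T\<^esub> t) = z \<otimes>\<^bsub>?T\<^esub> s \<otimes>\<^bsub>?T\<^esub> t" by (simp add: T.m_assoc)
    also have "\<dots> = s \<otimes>\<^bsub>?T\<^esub> (z \<otimes>\<^bsub>?T\<^esub> t)" using st by (simp add: T.m_assoc)
    also have "\<dots> = s \<otimes>\<^bsub>?T\<^esub> t \<otimes>\<^bsub>?T\<^esub> z" using st by (simp add: T.m_assoc)
    finally show "s \<otimes>\<^bsub>?T\<^esub> t \<in> ?K" using st by simp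
  next
    fix t assume "t \<in> ?K"
    then have [simp]: "t \<in> carrier ?T" and tz: "t \<otimes>\<^bsub>?T\<^esub> z = z \<otimes>\<^bsub>?T\<^esub> t" by auto
    have "t \<otimes>\<^bsub>?T\<^esub> (z \<otimes>\<^bsub>?T\<^esub> inv\<^bsub>?T\<^esub> t) = z"
      by (simp add: tz flip: T.m_assoc) (simp add: T.m_assoc)
    then show "inv\<^bsub>?T\<^esub> t \<in> ?K" by (simp add: T.inv_solve_left)
  qed auto
  have "tens G a b \<in> ?K" if "a \<in> carrier G" "b \<in> carrier G" for a b
    using that tensor_square_conj_tens[OF zc that] by (simp add: z1 conj_by_one tens_closed)
  then show ?thesis using tensor_square_generated[OF K] t by blast
qed

end

section \<open>The images of the kernels in the squares of the target\<close>

lemma tau_surj: "tau G ` carrier (tensor_square G) = carrier (ext_square G)"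
  by (auto simp: ext_square_def tau_def carrier_FactGroup)

context group
begin

lemma ext_comm_tau:
  assumes "t \<in> carrier (tensor_square G)"
  shows "ext_comm G (tau G t) = tensor_comm G t"
proof -
  have D: "group (commutator_subgroup G)"
    by (rule subgroup.subgroup_is_group[OF derived_is_subgroup]) (simp_all add: is_group)
  have "diagonal_closure G \<subseteq> kernel (tensor_square G) (commutator_subgroup G) (tensor_comm G)"
    by (rule diagonal_closure_subset_kernel[OF D tensor_comm_hom(1)])
      (simp add: tensor_comm_hom(2) commutator_def m_assoc)
  from induced_map_FactGroup(2)[OF diagonal_closure_normal D tensor_comm_hom(1) this assms]
  show ?thesis by (simp add: ext_comm_def tau_def)
qed

lemma H2_eq_tau_J2: "H2 G = tau G ` J2 G"
  by (auto simp: H2_def J2_def kernel_def ext_comm_tau simp flip: tau_surj)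

end

lemma tensor_comm_tensor_map:
  assumes "group \<Gamma>" "group G" "f \<in> hom \<Gamma> G" and t: "t \<in> carrier (tensor_square \<Gamma>)"
  shows "tensor_comm G (tensor_map \<Gamma> G f t) = f (tensor_comm \<Gamma> t)"
proof -
  interpret f: group_hom \<Gamma> G f using assms by (simp add: group_hom_def group_hom_axioms_def)
  interpret d: group_hom "tensor_square G" G "tensor_comm G" by (rule f.H.group_hom_tensor_comm)
  interpret d': group_hom "tensor_square \<Gamma>" \<Gamma> "tensor_comm \<Gamma>" by (rule f.G.group_hom_tensor_comm)
  interpret m: group_hom "tensor_square \<Gamma>" "tensor_square G" "tensor_map \<Gamma> G f"
    using tensor_map_hom(1)[OF assms(1-3)] by unfold_locales
  let ?K = "{t \<in> carrier (tensor_square \<Gamma>).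
      tensor_comm G (tensor_map \<Gamma> G f t) = f (tensor_comm \<Gamma> t)}"
  have K: "subgroup ?K (tensor_square \<Gamma>)"
    by (rule d'.G.subgroupI) auto
  have "tens \<Gamma> g h \<in> ?K" if "g \<in> carrier \<Gamma>" "h \<in> carrier \<Gamma>" for g h
    using that
    by (simp add: tens_closed tensor_map_hom(2)[OF assms(1-3)] f.G.tensor_comm_hom(2)
        f.H.tensor_comm_hom(2)) (simp add: commutator_def)
  then show ?thesis using tensor_square_generated[OF K] t by blast
qed

text \<open>Since \<open>f \<otimes> f\<close> need not be onto, normality cannot be transported from \<open>\<Gamma> \<otimes> \<Gamma>\<close>.  It
  holds because the image lies in \<open>J\<^sub>2(G)\<close>, which is central.\<close>

lemma J2_image_normal:
  assumes "group \<Gamma>" "group G" "f \<in> hom \<Gamma> G"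
  shows "J2_image \<Gamma> G f \<lhd> tensor_square G"
proof -
  interpret f: group_hom \<Gamma> G f using assms by (simp add: group_hom_def group_hom_axioms_def)
  interpret m: group_hom "tensor_square \<Gamma>" "tensor_square G" "tensor_map \<Gamma> G f"
    using tensor_map_hom(1)[OF assms] by (simp add: group_hom_def group_hom_axioms_def group_tensor_square)
  interpret d: group_hom "tensor_square \<Gamma>" \<Gamma> "tensor_comm \<Gamma>" by (rule f.G.group_hom_tensor_comm)
  have "subgroup (J2 \<Gamma>) (tensor_square \<Gamma>)"
    using d.subgroup_kernel by (simp add: J2_def kernel_def)
  then have sub: "subgroup (J2_image \<Gamma> G f) (tensor_square G)"
    unfolding J2_image_def by (rule m.subgroup_img_is_subgroup)
  have J: "J2_image \<Gamma> G f \<subseteq> J2 G"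
    by (auto simp: J2_image_def f.G.J2_eq f.H.J2_eq tensor_comm_tensor_map[OF assms])
  show ?thesis
  proof (rule m.H.normal_invI[OF sub])
    fix t z assume t: "t \<in> carrier (tensor_square G)" and z: "z \<in> J2_image \<Gamma> G f"
    have zc: "z \<in> carrier (tensor_square G)" using z sub subgroup.subset by blast
    have "t \<otimes>\<^bsub>tensor_square G\<^esub> z = z \<otimes>\<^bsub>tensor_square G\<^esub> t"
      using f.H.J2_central[OF subsetD[OF J z] t] by (rule HOL.sym)
    then have "t \<otimes>\<^bsub>tensor_square G\<^esub> z \<otimes>\<^bsub>tensor_square G\<^esub> inv\<^bsub>tensor_square G\<^esub> t = z"
      using t zc by (simp add: m.H.m_assoc)
    then show "t \<otimes>\<^bsub>tensor_square G\<^esub> z \<otimes>\<^bsub>tensor_square G\<^esub> inv\<^bsub>tensor_square G\<^esub> t \<in> J2_image \<Gamma> G f"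
      using z by simp
  qed
qed

lemma H2_image_eq_tau_J2_image:
  assumes "group \<Gamma>" "group G" "f \<in> hom \<Gamma> G"
  shows "H2_image \<Gamma> G f = tau G ` J2_image \<Gamma> G f"
  unfolding H2_image_def J2_image_def group.H2_eq_tau_J2[OF assms(1)] image_image
  using ext_map_hom(2)[OF assms] by (intro image_cong) (auto simp: group.J2_eq[OF assms(1)])

section \<open>Surjections modulo a normal subgroup and its image\<close>

context group_hom
begin

lemma induced_Mod_image:
  assumes surj: "h ` carrier G = carrier H" and J: "J \<lhd> G"
  defines "\<Phi> \<equiv> induced_map (\<lambda>t. h ` J #>\<^bsub>H\<^esub> h t)"
  shows "group_hom (G Mod J) (H Mod h ` J) \<Phi>"
    and "t \<in> carrier G \<Longrightarrow> \<Phi> (J #>\<^bsub>G\<^esub> t) = h ` J #>\<^bsub>H\<^esub> h t"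
    and "\<Phi> ` carrier (G Mod J) = carrier (H Mod h ` J)"
    and "kernel (G Mod J) (H Mod h ` J) \<Phi> = (\<lambda>t. J #>\<^bsub>G\<^esub> t) ` kernel G H h"
proof -
  interpret J: normal J G by fact
  have N: "h ` J \<lhd> H"
    by (rule J.surj_hom_normal_subgroup[OF group_hom_axioms surj])
  interpret N: normal "h ` J" H by fact
  have Q: "group (H Mod h ` J)" by (rule N.factorgroup_is_group)
  have hom: "(\<lambda>t. h ` J #>\<^bsub>H\<^esub> h t) \<in> hom G (H Mod h ` J)"
    using Group.hom_compose[OF homh N.r_coset_hom_Mod] by (simp add: comp_def)
  have "J \<subseteq> kernel G (H Mod h ` J) (\<lambda>t. h ` J #>\<^bsub>H\<^esub> h t)"
    using N.rcos_const[OF H.is_group] by (auto simp: kernel_def)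
  note \<Phi> = induced_map_FactGroup[OF J Q hom this, folded \<Phi>_def]
  show "group_hom (G Mod J) (H Mod h ` J) \<Phi>"
    using \<Phi>(1) Q J.factorgroup_is_group by (simp add: group_hom_def group_hom_axioms_def)
  show "\<Phi> (J #>\<^bsub>G\<^esub> t) = h ` J #>\<^bsub>H\<^esub> h t" if "t \<in> carrier G" using \<Phi>(2) that .
  show "\<Phi> ` carrier (G Mod J) = carrier (H Mod h ` J)"
    unfolding carrier_FactGroup image_image surj[symmetric] using \<Phi>(2) by (intro image_cong) auto
  show "kernel (G Mod J) (H Mod h ` J) \<Phi> = (\<lambda>t. J #>\<^bsub>G\<^esub> t) ` kernel G H h"
  proof
    show "(\<lambda>t. J #>\<^bsub>G\<^esub> t) ` kernel G H h \<subseteq> kernel (G Mod J) (H Mod h ` J) \<Phi>"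
      using \<Phi>(2) N.subset by (auto simp: kernel_def carrier_FactGroup)
  next
    show "kernel (G Mod J) (H Mod h ` J) \<Phi> \<subseteq> (\<lambda>t. J #>\<^bsub>G\<^esub> t) ` kernel G H h"
    proof
      fix X assume "X \<in> kernel (G Mod J) (H Mod h ` J) \<Phi>"
      then obtain t where t: "t \<in> carrier G" "X = J #>\<^bsub>G\<^esub> t" "h ` J #>\<^bsub>H\<^esub> h t = h ` J"
        using \<Phi>(2) by (auto simp: kernel_def carrier_FactGroup)
      then have "h t \<in> h ` J"
        using H.rcos_self[of "h t" "h ` J"] N.subgroup_axioms by simp
      \<comment> \<open>Translating \<open>t\<close> by \<open>j\<^sup>-\<^sup>1\<close> moves it into the kernel of \<open>h\<close> within its coset.\<close>
      then obtain j where j: "j \<in> J" "h t = h j" by blast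
      then have jc: "j \<in> carrier G" by simp
      have "inv j \<otimes>\<^bsub>G\<^esub> t \<in> kernel G H h" using t j jc by (simp add: kernel_def)
      moreover have "J #>\<^bsub>G\<^esub> (inv j \<otimes>\<^bsub>G\<^esub> t) = X"
        using t j jc G.coset_mult_assoc[of J "inv j" t] J.subset J.rcos_const[OF G.is_group, of "inv j"]
        by simp
      ultimately show "X \<in> (\<lambda>t. J #>\<^bsub>G\<^esub> t) ` kernel G H h" by blast
    qed
  qed
qed

end

text \<open>The second isomorphism theorem in the form \<open>KJ/J \<cong> K/(K \<inter> J)\<close>, with \<open>KJ/J\<close> written as the
  image of \<open>K\<close> in \<open>G/J\<close>, the form in which kernels of induced maps arise.\<close>

lemma (in group) image_in_Mod_iso:
  assumes K: "subgroup K G" and J: "J \<lhd> G"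
  shows "(G Mod J)\<lparr>carrier := (\<lambda>t. J #> t) ` K\<rparr> \<cong> G\<lparr>carrier := K\<rparr> Mod (K \<inter> J)"
proof -
  interpret J: normal J G by fact
  interpret p: group_hom G "G Mod J" "\<lambda>t. J #> t"
    by (simp add: group_hom_def group_hom_axioms_def J.factorgroup_is_group J.r_coset_hom_Mod is_group)
  let ?K = "G\<lparr>carrier := K\<rparr>" and ?I = "(G Mod J)\<lparr>carrier := (\<lambda>t. J #> t) ` K\<rparr>"
  have "group ?K" by (rule subgroup.subgroup_is_group[OF K is_group])
  moreover have "group ?I"
    by (rule subgroup.subgroup_is_group[OF p.subgroup_img_is_subgroup[OF K] p.H.is_group])
  moreover have "(\<lambda>t. J #> t) \<in> hom ?K ?I"
    using p.hom_mult subgroup.mem_carrier[OF K] by (auto simp: hom_def)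
  ultimately interpret q: group_hom ?K ?I "\<lambda>t. J #> t"
    by (simp add: group_hom_def group_hom_axioms_def)
  have "kernel ?K ?I (\<lambda>t. J #> t) = K \<inter> J"
    using subgroup.mem_carrier[OF K] rcos_self[OF _ J.subgroup_axioms] J.rcos_const[OF is_group]
    by (fastforce simp: kernel_def)
  with q.FactGroup_iso have "?K Mod (K \<inter> J) \<cong> ?I" by simp
  moreover have "group (?K Mod (K \<inter> J))"
    using normal.factorgroup_is_group[OF q.normal_kernel] \<open>kernel _ _ _ = _\<close> by simp
  ultimately show ?thesis using group.iso_sym by blast
qed

lemma (in group_hom) short_exact_kernel:
  assumes "h ` carrier G = carrier H"
  shows "short_exact (G\<lparr>carrier := kernel G H h\<rparr>) G H (\<lambda>x. x) h"
proof -
  have "group (G\<lparr>carrier := kernel G H h\<rparr>)"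
    by (rule subgroup.subgroup_is_group[OF subgroup_kernel G.is_group])
  then have "group_hom (G\<lparr>carrier := kernel G H h\<rparr>) G (\<lambda>x. x)"
    by (auto simp: group_hom_def group_hom_axioms_def hom_def kernel_def G.is_group)
  then show ?thesis
    unfolding short_exact_def using assms group_hom_axioms by (auto simp: kernel_def)
qed

section \<open>The exact sequence\<close>

theorem proposition4p8:
  fixes \<Gamma> :: "('a, 'm) monoid_scheme" and G :: "('b, 'n) monoid_scheme"
    and f :: "'a \<Rightarrow> 'b"
  assumes "group \<Gamma>" and "group G" and "f \<in> hom \<Gamma> G"
  shows "(\<forall>t \<in> carrier (tensor_square G).
            tau_rel \<Gamma> G f (J2_image \<Gamma> G f #>\<^bsub>tensor_square G\<^esub> t) =
            H2_image \<Gamma> G f #>\<^bsub>ext_square G\<^esub> tau G t) \<and>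
         short_exact
            ((tensor_square_rel \<Gamma> G f)\<lparr>carrier := nabla_rel \<Gamma> G f\<rparr>)
            (tensor_square_rel \<Gamma> G f) (ext_square_rel \<Gamma> G f)
            (\<lambda>x. x) (tau_rel \<Gamma> G f) \<and>
         (tensor_square_rel \<Gamma> G f)\<lparr>carrier := nabla_rel \<Gamma> G f\<rparr> \<cong>
            (tensor_square G)\<lparr>carrier := nabla G\<rparr> Mod (nabla G \<inter> J2_image \<Gamma> G f)"
proof -
  interpret tau: group_hom "tensor_square G" "ext_square G" "tau G"
    by (simp add: group_hom_def group_hom_axioms_def group_tensor_square group_ext_square tau_hom)
  note J = J2_image_normal[OF assms]
  note Q = tau.induced_Mod_image[OF tau_surj J,
      folded H2_image_eq_tau_J2_image[OF assms], folded tau_rel_def tensor_square_rel_def ext_square_rel_def]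
  interpret tau_rel: group_hom "tensor_square_rel \<Gamma> G f" "ext_square_rel \<Gamma> G f" "tau_rel \<Gamma> G f"
    by (rule Q(1))
  have nabla_rel: "nabla_rel \<Gamma> G f = (\<lambda>t. J2_image \<Gamma> G f #>\<^bsub>tensor_square G\<^esub> t) ` nabla G"
    using Q(4) by (simp add: nabla_rel_def nabla_def)
  have "subgroup (nabla G) (tensor_square G)"
    using tau.subgroup_kernel by (simp add: nabla_def)
  from tau.G.image_in_Mod_iso[OF this J]
  show ?thesis
    using Q(2) tau_rel.short_exact_kernel[OF Q(3), folded nabla_rel_def]
    by (simp add: nabla_rel tensor_square_rel_def)
qed

end
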